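(* Let $X, Y$ be linear spaces (both real or both complex) lattice-normed by Dedekind $\sigma$-complete Riesz spaces $X', Y'$ respectively, with $Y$ a $B_K$ space. Let $$\Psi(X,Y)=(o)\text{-}\sum_{m+n\ge 1}\frac{1}{m!\,n!}A_{mn}(\underbrace{X,\dots,X}_{m};\underbrace{Y,\dots,Y}_{n}),\qquad \psi(x,y)=(bk)\text{-}\sum_{m+n\ge 1}\frac{1}{m!\,n!}a_{mn}(\underbrace{x,\dots,x}_{m};\underbrace{y,\dots,y}_{n}),$$ where $A_{mn}:(X')^m\times (Y')^n\to Y'$ and $a_{mn}:X^m\times Y^n\to Y$ are multilinear and completely symmetrical in the first $m$ variables and in the last $n$ variables, each $A_{mn}$ is continuous for monotone convergence, $A_{01}=0$, $a_{01}=0$, the series for $\Psi$ is $(o)$-convergent for all $(X,Y)\in\mathcal{E}'$, where $\mathcal{E}'$ is an order-star in $X'_+\times Y'_+$, and $\psi\ll\Psi$. Let $$\Phi(X)=\sum_{n=1}^\infty\frac1{n!}B_n(X,\dots,X),\qquad \varphi(x)=\sum_{n=1}^\infty\frac1{n!}b_n(x,\dots,x)$$ be the formal series solutions of $Y=\Psi(X,Y)$ and $y=\psi(x,y)$ respectively (found by series substitution). Put $$\Delta_1=\{X\in X'_+\mid \exists\, Y\in Y'_+:\ (X,Y)\in\mathcal{E}',\ Y\ge\Psi(X,Y)\},\qquad \Gamma_1=\{X\in X'_+\mid \exists\, Y\in Y'_+:\ (X,Y)\in\mathcal{E}',\ Y=\Psi(X,Y)\}$$ (these two sets are equal). Then: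 (a) The solution $Y=\Phi(X)$ of $Y=\Psi(X,Y)$ found by series substitution is $(o)$-convergent for $X\in\Delta_1\ (=\Gamma_1)$ and, for these values of $X$, coincides with the principal solution $Y(X)$. (b) The solution $y=\varphi(x)$ of $y=\psi(x,y)$ found by series substitution has the Cauchy majorant $\Phi$ (i.e. $\varphi\ll\Phi$) and is $(bk)$-convergent when $\|x\|\le X$ for some $X\in\Delta_1\ (=\Gamma_1)$.
   Context: A Riesz space is Dedekind $\sigma$-complete if every countable nonempty subset bounded above has a supremum. In such a space, $X^{(p)}\uparrow X$ means the sequence is increasing with supremum $X$; a sequence $X^{(p)}$ is $(o)$-convergent to $X$ if there is a sequence $\varepsilon^{(p)}\downarrow 0$ (decreasing with infimum $0$) with $|X^{(p)}-X|\le\varepsilon^{(p)}$ for all $p$. $X'_+$ is the set of elements $\ge 0$. A linear space $X$ is lattice-normed by a Riesz space $X'$ if there is a map $\|\cdot\|:X\to X'$ with $\|x\|\ge0$, $\|x\|=0\Rightarrow x=0$, $\|x_1+x_2\|\le\|x_1\|+\|x_2\|$, $\|\lambda x\|=|\lambda|\|x\|$. A sequence $x_p$ is $(bk)$-convergent to $x$ if $\|x_p-x\|$ is $(o)$-convergent to $0$; it is $(bk)$-fundamental if there is a sequence $\varepsilon_n\downarrow0$ in $X'$ with $\|x_p-x_q\|\le\varepsilon_n$ for all $p,q\ge n$. A $B_K$ space is a linear space lattice-normed by a Dedekind $\sigma$-complete Riesz space in which every $(bk)$-fundamental sequence is $(bk)$-convergent. $(o)$-sums and $(bk)$-sums of series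 are the $(o)$-, $(bk)$-limits of partial sums. An order-star in a positive cone is a set $S$ that contains, with any element $Z$, the whole order interval $\langle 0,Z\rangle=\{W: 0\le W\le Z\}$; $X'\times Y'$ is ordered componentwise. "$A_{mn}$ continuous for monotone convergence" means: if $X_i^{(p)}\uparrow X_i$ and $Y_j^{(p)}\uparrow Y_j$ with all elements $\geq 0$, then $A_{mn}(X_1^{(p)},\dots;Y_1^{(p)},\dots)\uparrow A_{mn}(X_1,\dots;Y_1,\dots)$. $\psi\ll\Psi$ ($\Psi$ is a Cauchy majorant of $\psi$) means: each $A_{mn}$ is positive (nonnegative on nonnegative arguments), and $\|a_{mn}(x_1,\dots,x_m;y_1,\dots,y_n)\|\le A_{mn}(X_1,\dots,X_m;Y_1,\dots,Y_n)$ whenever $\|x_i\|\le X_i$, $\|y_j\|\le Y_j$. Similarly $\varphi\ll\Phi$ means each $B_n$ is positive and $\|b_n(x_1,\dots,x_n)\|\le B_n(X_1,\dots,X_n)$ whenever $\|x_i\|\le X_i$. Formal series solution of $y=\psi(x,y)$: the formal power series $\varphi$ whose completely symmetrical multilinear coefficients $b_n$ are determined by substituting $y=\varphi(x)$ and equating terms of equal degree; explicitly, recursively, $$b_n(x_1,\dots,x_n)=\sum a_{mr}\big(x_M;\,b_{|S_1|}(x_{S_1}),\dots,b_{|S_r|}(x_{S_r})\big),$$ the sum being over all subsets $M\subseteq\{1,\dots,n\}$ (possibly empty), $m=|M|$, and all unordered partitions $\{S_1,\dots,S_r\}$ of $\{1,\dots,n\}\setminus M$ into $r\ge0$ nonempty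 blocks, where $x_S$ denotes the list of $x_i$, $i\in S$. (Since $a_{01}=0$, $b_n$ does not occur on the right.) $B_n$ is determined in the same way from the $A_{mn}$. Principal solution: for $X\in\Delta_1$ put $Y^{(0)}(X)=0$, $Y^{(p+1)}(X)=\Psi(X,Y^{(p)}(X))$; this sequence is well defined, increasing and bounded, and the principal solution is $Y(X)=\sup_p Y^{(p)}(X)$, which satisfies $Y(X)=\Psi(X,Y(X))$. *)

theory Defs
  imports
    Complex_Main
    "HOL-Library.Countable_Set"
    "HOL-Library.Multiset"
    "HOL-Library.Lattice_Algebras"
    "HOL-Library.Lub_Glb"
    "HOL-Library.Product_Order"
    "HOL-Library.Product_Plus"
    "HOL-Library.Disjoint_Sets"
begin

section \<open>Riesz spaces and order convergence\<close>

text \<open>The absolute value is the one of \<^class>\<open>lattice_ab_group_add_abs\<close>, i.e. the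
  supremum of \<open>a\<close> and \<open>- a\<close>.\<close>

class riesz_space = ordered_real_vector + lattice_ab_group_add_abs

class sigma_complete_riesz_space = riesz_space +
  assumes countable_sup_exists:
    "\<lbrakk>countable S; S \<noteq> {}; \<forall>x\<in>S. x \<le> u\<rbrakk>
      \<Longrightarrow> \<exists>s. (\<forall>x\<in>S. x \<le> s) \<and> (\<forall>v. (\<forall>x\<in>S. x \<le> v) \<longrightarrow> s \<le> v)"

definition increases_to :: "(nat \<Rightarrow> 'a::order) \<Rightarrow> 'a \<Rightarrow> bool"  (infix \<open>\<up>\<close> 50) where
  "U \<up> V \<longleftrightarrow> incseq U \<and> isLub UNIV (range U) V"

definition decreases_to :: "(nat \<Rightarrow> 'a::order) \<Rightarrow> 'a \<Rightarrow> bool"  (infix \<open>\<down>\<close> 50) where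
  "U \<down> V \<longleftrightarrow> decseq U \<and> isGlb UNIV (range U) V"

definition o_converges :: "(nat \<Rightarrow> 'a::riesz_space) \<Rightarrow> 'a \<Rightarrow> bool" where
  "o_converges U V \<longleftrightarrow> (\<exists>\<epsilon>. \<epsilon> \<down> 0 \<and> (\<forall>p. \<bar>U p - V\<bar> \<le> \<epsilon> p))"

definition o_lim :: "(nat \<Rightarrow> 'a::riesz_space) \<Rightarrow> 'a" where
  "o_lim U = (THE V. o_converges U V)"

text \<open>Pairs carry the componentwise order of \<^theory>\<open>HOL-Library.Product_Order\<close>.\<close>

definition order_star :: "'a::{zero, order} set \<Rightarrow> bool" where
  "order_star S \<longleftrightarrow> S \<subseteq> {0..} \<and> (\<forall>Z\<in>S. {0..Z} \<subseteq> S)"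


section \<open>Lattice-normed spaces\<close>

text \<open>The scalar field is an arbitrary \<^class>\<open>real_normed_field\<close>. Since its norm is
  multiplicative, Ostrowski's theorem shows that such a field is isometrically isomorphic to the
  real or to the complex numbers; so this covers precisely the real and the complex case.\<close>

locale lattice_normed_space = vector_space scale
  for scale :: "'k::real_normed_field \<Rightarrow> 'x::ab_group_add \<Rightarrow> 'x" +
  fixes nrm :: "'x \<Rightarrow> 'r::riesz_space"
  assumes nrm_nonneg: "0 \<le> nrm x"
    and nrm_eq_zeroD: "nrm x = 0 \<Longrightarrow> x = 0"
    and nrm_triangle: "nrm (x + y) \<le> nrm x + nrm y"
    and nrm_scale: "nrm (scale c x) = norm c *\<^sub>R nrm x"

definition bk_converges :: "('x::ab_group_add \<Rightarrow> 'r::riesz_space) \<Rightarrow> (nat \<Rightarrow> 'x) \<Rightarrow> 'x \<Rightarrow> bool" where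
  "bk_converges nrm u x \<longleftrightarrow> o_converges (\<lambda>p. nrm (u p - x)) 0"

definition bk_fundamental :: "('x::ab_group_add \<Rightarrow> 'r::riesz_space) \<Rightarrow> (nat \<Rightarrow> 'x) \<Rightarrow> bool" where
  "bk_fundamental nrm u \<longleftrightarrow>
     (\<exists>\<epsilon>. \<epsilon> \<down> 0 \<and> (\<forall>n. \<forall>p\<ge>n. \<forall>q\<ge>n. nrm (u p - u q) \<le> \<epsilon> n))"

locale B_K_space = lattice_normed_space scale nrm
  for scale :: "'k::real_normed_field \<Rightarrow> 'x::ab_group_add \<Rightarrow> 'x"
    and nrm :: "'x \<Rightarrow> 'r::sigma_complete_riesz_space" +
  assumes bk_complete: "bk_fundamental nrm u \<Longrightarrow> \<exists>x. bk_converges nrm u x"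


section \<open>Coefficient families\<close>

text \<open>A family \<open>f\<^sub>m\<^sub>n\<close> of functions of \<open>m\<close> variables in \<open>X\<close> and \<open>n\<close> variables in \<open>Y\<close> is a single
  function \<open>f\<close> on pairs of lists: \<open>f\<^sub>m\<^sub>n(x\<^sub>1,\<dots>,x\<^sub>m; y\<^sub>1,\<dots>,y\<^sub>n)\<close> is \<open>f [x\<^sub>1,\<dots>,x\<^sub>m] [y\<^sub>1,\<dots>,y\<^sub>n]\<close>.
  Likewise \<open>b\<^sub>n(x\<^sub>1,\<dots>,x\<^sub>n)\<close> is \<open>b [x\<^sub>1,\<dots>,x\<^sub>n]\<close>. The value \<open>f [] []\<close> is not part of the data
  (\<open>m + n \<ge> 1\<close>), hence the conditions below never constrain it.\<close>

definition multilinear ::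
  "('k::field \<Rightarrow> 'x::ab_group_add \<Rightarrow> 'x) \<Rightarrow> ('k \<Rightarrow> 'y::ab_group_add \<Rightarrow> 'y)
    \<Rightarrow> ('x list \<Rightarrow> 'y list \<Rightarrow> 'y) \<Rightarrow> bool" where
  "multilinear sX sY f \<longleftrightarrow>
     (\<forall>xs ys. \<forall>i<length xs. Vector_Spaces.linear sX sY (\<lambda>x. f (xs[i := x]) ys)) \<and>
     (\<forall>xs ys. \<forall>j<length ys. Vector_Spaces.linear sY sY (\<lambda>y. f xs (ys[j := y])))"

definition completely_symmetrical :: "('x list \<Rightarrow> 'y list \<Rightarrow> 'z) \<Rightarrow> bool" where
  "completely_symmetrical f \<longleftrightarrow>
     (\<forall>xs xs' ys ys'. mset xs = mset xs' \<longrightarrow> mset ys = mset ys' \<longrightarrow> f xs ys = f xs' ys')"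

definition continuous_monotone ::
  "('p::{zero, order} list \<Rightarrow> 'q::{zero, order} list \<Rightarrow> 'q) \<Rightarrow> bool" where
  "continuous_monotone A \<longleftrightarrow>
     (\<forall>Us Xs Vs Ys. (Us \<noteq> [] \<or> Vs \<noteq> []) \<longrightarrow>
        list_all2 (\<lambda>U X. (\<forall>p. 0 \<le> U p) \<and> U \<up> X) Us Xs \<longrightarrow>
        list_all2 (\<lambda>V Y. (\<forall>p. 0 \<le> V p) \<and> V \<up> Y) Vs Ys \<longrightarrow>
        (\<lambda>p. A (map (\<lambda>U. U p) Us) (map (\<lambda>V. V p) Vs)) \<up> A Xs Ys)"

text \<open>\<open>\<psi> \<lless> \<Psi>\<close>, in terms of the coefficients \<open>a\<close> of \<open>\<psi>\<close> and \<open>A\<close> of \<open>\<Psi>\<close>:\<close>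

definition majorant2 ::
  "('x \<Rightarrow> 'p::{zero, order}) \<Rightarrow> ('y \<Rightarrow> 'q::{zero, order})
    \<Rightarrow> ('x list \<Rightarrow> 'y list \<Rightarrow> 'y) \<Rightarrow> ('p list \<Rightarrow> 'q list \<Rightarrow> 'q) \<Rightarrow> bool" where
  "majorant2 nX nY a A \<longleftrightarrow>
     (\<forall>Xs Ys. (Xs \<noteq> [] \<or> Ys \<noteq> []) \<longrightarrow> (\<forall>X\<in>set Xs. 0 \<le> X) \<longrightarrow> (\<forall>Y\<in>set Ys. 0 \<le> Y) \<longrightarrow>
        0 \<le> A Xs Ys) \<and>
     (\<forall>xs Xs ys Ys. (xs \<noteq> [] \<or> ys \<noteq> []) \<longrightarrow>
        list_all2 (\<lambda>x X. nX x \<le> X) xs Xs \<longrightarrow> list_all2 (\<lambda>y Y. nY y \<le> Y) ys Ys \<longrightarrow>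
        nY (a xs ys) \<le> A Xs Ys)"

text \<open>\<open>\<phi> \<lless> \<Phi>\<close>, in terms of the coefficients \<open>b\<close> of \<open>\<phi>\<close> and \<open>B\<close> of \<open>\<Phi>\<close>:\<close>

definition majorant1 ::
  "('x \<Rightarrow> 'p::{zero, order}) \<Rightarrow> ('y \<Rightarrow> 'q::{zero, order})
    \<Rightarrow> ('x list \<Rightarrow> 'y) \<Rightarrow> ('p list \<Rightarrow> 'q) \<Rightarrow> bool" where
  "majorant1 nX nY b B \<longleftrightarrow>
     (\<forall>Xs. Xs \<noteq> [] \<longrightarrow> (\<forall>X\<in>set Xs. 0 \<le> X) \<longrightarrow> 0 \<le> B Xs) \<and>
     (\<forall>xs Xs. xs \<noteq> [] \<longrightarrow> list_all2 (\<lambda>x X. nX x \<le> X) xs Xs \<longrightarrow> nY (b xs) \<le> B Xs)"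


section \<open>Power series\<close>

text \<open>Partial sums of the double series are taken by total degree. The double series is evaluated
  below only on positive cones, where its terms are nonnegative, so that its sum does not depend on
  the order of summation.\<close>

definition partial_sum2 ::
  "('k::real_normed_field \<Rightarrow> 'y \<Rightarrow> 'y) \<Rightarrow> ('x list \<Rightarrow> 'y list \<Rightarrow> 'y::ab_group_add)
    \<Rightarrow> 'x \<Rightarrow> 'y \<Rightarrow> nat \<Rightarrow> 'y" where
  "partial_sum2 sY f x y N =
     (\<Sum>(m, n) | 1 \<le> m + n \<and> m + n \<le> N.
        sY (1 / (fact m * fact n)) (f (replicate m x) (replicate n y)))"

definition partial_sum1 ::
  "('k::real_normed_field \<Rightarrow> 'y \<Rightarrow> 'y) \<Rightarrow> ('x list \<Rightarrow> 'y::ab_group_add) \<Rightarrow> 'x \<Rightarrow> nat \<Rightarrow> 'y" where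
  "partial_sum1 sY b x N = (\<Sum>n=1..N. sY (1 / fact n) (b (replicate n x)))"

definition Psi :: "('p list \<Rightarrow> 'q list \<Rightarrow> 'q) \<Rightarrow> 'p \<Rightarrow> 'q::riesz_space \<Rightarrow> 'q" where
  "Psi A X Y = o_lim (partial_sum2 (*\<^sub>R) A X Y)"


section \<open>Formal series solution\<close>

text \<open>The blocks of a partition of a finite set of indices, listed without repetition in an
  unspecified order, which is immaterial when the coefficients are completely symmetrical.\<close>

definition blocks :: "nat set set \<Rightarrow> nat set list" where
  "blocks P = (SOME Ss. distinct Ss \<and> set Ss = P)"

lemma
  assumes "partition_on A P" "finite A"
  shows set_blocks: "set (blocks P) = P" and distinct_blocks: "distinct (blocks P)"
proof -
  have "finite P" using assms finite_elements by blast
  then have "\<exists>Ss. distinct Ss \<and> set Ss = P" using finite_distinct_list by blast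
  then have "distinct (blocks P) \<and> set (blocks P) = P"
    unfolding blocks_def by (rule someI_ex)
  then show "set (blocks P) = P" "distinct (blocks P)" by auto
qed

lemma length_nths_block:
  assumes P: "partition_on ({..<length xs} - M) P" and ne: "P \<noteq> {{..<length xs}}"
    and S: "S \<in> set (blocks P)"
  shows "length (nths xs S) < length xs"
proof -
  have SP: "S \<in> P" using S set_blocks[OF P] by simp
  have sub: "T \<subseteq> {..<length xs}" if "T \<in> P" for T
    using Union_upper[OF that] unfolding partition_onD1[OF P, symmetric] by (rule order_trans) simp
  have "S \<noteq> {..<length xs}"
  proof
    assume eq: "S = {..<length xs}"
    have "T = S" if "T \<in> P" for T
    proof (rule ccontr)
      assume "T \<noteq> S"
      then have "T \<inter> S = {}" by (rule disjointD[OF partition_onD2[OF P] that SP])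
      then have "T = {}" using sub[OF that] eq by (simp add: Int_absorb2)
      then show False using that partition_onD3[OF P] by simp
    qed
    then have "P = {S}" using SP by blast
    then show False using ne eq by simp
  qed
  then have "S \<subset> {..<length xs}" using sub[OF SP] by (rule psubsetI[rotated])
  then have "card S < card {..<length xs}" by (rule psubset_card_mono[OF finite_lessThan])
  moreover have "{i. i < length xs \<and> i \<in> S} = S" using sub[OF SP] by auto
  ultimately show ?thesis by (simp add: length_nths)
qed

text \<open>The coefficients \<open>b\<^sub>n\<close> obtained by substituting \<open>y = \<phi>(x)\<close> into \<open>y = \<psi>(x, y)\<close>, where \<open>a\<close> are
  the coefficients of \<open>\<psi>\<close> and \<open>x\<^sub>S\<close> is \<open>nths xs S\<close> (positions are counted from 0). The only term
  left out, \<open>M = {}\<close> with the one-block partition, is \<open>a\<^sub>0\<^sub>1(b\<^sub>n)\<close>, which vanishes when \<open>a\<^sub>0\<^sub>1 = 0\<close>;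
  see \<open>series_solution_full\<close>. The value at \<open>[]\<close> is irrelevant.\<close>

function series_solution ::
  "('x list \<Rightarrow> 'y list \<Rightarrow> 'y::comm_monoid_add) \<Rightarrow> 'x list \<Rightarrow> 'y" where
  "series_solution a xs =
     (\<Sum>M\<in>Pow {..<length xs}.
        \<Sum>P | partition_on ({..<length xs} - M) P \<and> P \<noteq> {{..<length xs}}.
          a (nths xs M) (map (\<lambda>S. series_solution a (nths xs S)) (blocks P)))"
  by pat_completeness auto

termination
  by (relation "measure (\<lambda>(a, xs). length xs)") (simp, auto intro: length_nths_block)

declare series_solution.simps [simp del]

lemma series_solution_full:
  fixes a :: "'x list \<Rightarrow> 'y list \<Rightarrow> 'y::comm_monoid_add"
  assumes a01: "\<And>y. a [] [y] = 0"
  shows "series_solution a xs =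
     (\<Sum>M\<in>Pow {..<length xs}. \<Sum>P | partition_on ({..<length xs} - M) P.
        a (nths xs M) (map (\<lambda>S. series_solution a (nths xs S)) (blocks P)))"
proof (subst series_solution.simps, rule sum.cong[OF refl])
  fix M assume "M \<in> Pow {..<length xs}"
  then have M: "M \<subseteq> {..<length xs}" by simp
  let ?t = "\<lambda>P. a (nths xs M) (map (\<lambda>S. series_solution a (nths xs S)) (blocks P))"
  show "sum ?t {P. partition_on ({..<length xs} - M) P \<and> P \<noteq> {{..<length xs}}}
      = sum ?t {P. partition_on ({..<length xs} - M) P}"
  proof (rule sum.mono_neutral_left)
    show "finite {P. partition_on ({..<length xs} - M) P}"
      by (rule finitely_many_partition_on) simp
    show "\<forall>P \<in> {P. partition_on ({..<length xs} - M) P}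
          - {P. partition_on ({..<length xs} - M) P \<and> P \<noteq> {{..<length xs}}}. ?t P = 0"
    proof
      fix P assume "P \<in> {P. partition_on ({..<length xs} - M) P}
          - {P. partition_on ({..<length xs} - M) P \<and> P \<noteq> {{..<length xs}}}"
      then have P: "partition_on ({..<length xs} - M) P" and eq: "P = {{..<length xs}}" by auto
      have "{..<length xs} - M = {..<length xs}"
        unfolding partition_onD1[OF P] eq by simp
      then have "M = {}" using M by blast
      moreover have "blocks P = [{..<length xs}]"
      proof -
        have st: "set (blocks P) = {{..<length xs}}" "distinct (blocks P)"
          using set_blocks[OF P] distinct_blocks[OF P] unfolding eq by simp_all
        have "length (blocks P) = Suc 0" using distinct_card[OF st(2)] unfolding st(1) by simp
        then obtain S where "blocks P = [S]" unfolding length_Suc_conv by blast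
        then show ?thesis using st(1) by simp
      qed
      ultimately show "?t P = 0" by (simp only: nths_empty list.map a01)
    qed
  qed blast
qed


section \<open>The equation \<open>Y = \<Psi>(X, Y)\<close>\<close>

definition Delta1 ::
  "('p::riesz_space list \<Rightarrow> 'q::riesz_space list \<Rightarrow> 'q) \<Rightarrow> ('p \<times> 'q) set \<Rightarrow> 'p set" where
  "Delta1 A E = {X. 0 \<le> X \<and> (\<exists>Y\<ge>0. (X, Y) \<in> E \<and> Y \<ge> Psi A X Y)}"

definition Gamma1 ::
  "('p::riesz_space list \<Rightarrow> 'q::riesz_space list \<Rightarrow> 'q) \<Rightarrow> ('p \<times> 'q) set \<Rightarrow> 'p set" where
  "Gamma1 A E = {X. 0 \<le> X \<and> (\<exists>Y\<ge>0. (X, Y) \<in> E \<and> Y = Psi A X Y)}"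

definition iterate :: "('p list \<Rightarrow> 'q list \<Rightarrow> 'q) \<Rightarrow> 'p \<Rightarrow> nat \<Rightarrow> 'q::riesz_space" where
  "iterate A X p = (Psi A X ^^ p) 0"

definition is_principal_solution ::
  "('p list \<Rightarrow> 'q list \<Rightarrow> 'q) \<Rightarrow> 'p \<Rightarrow> 'q::riesz_space \<Rightarrow> bool" where
  "is_principal_solution A X Y \<longleftrightarrow> isLub UNIV (range (iterate A X)) Y"

end

theory Submission
  imports Defs "HOL-Combinatorics.Multiset_Permutations"
begin

text \<open>Fix \<open>X\<close> in \<open>Delta1\<close> and put \<open>c\<^sub>n = B\<^sub>n(X,\<dots>,X) / n!\<close> and \<open>S\<^sub>N = c\<^sub>1 + \<dots> + c\<^sub>N\<close>. In the recursion
  for \<open>B\<^sub>n\<close>, each choice of a number \<open>m\<close> and of block sizes \<open>k\<^sub>1 + \<dots> + k\<^sub>r = n - m\<close> comes from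
  \<open>n! / (m! k\<^sub>1! \<dots> k\<^sub>r!)\<close> choices of a set \<open>M\<close> and of an ordered list of blocks, and each partition is
  listed in \<open>r!\<close> orders. After division by \<open>n!\<close> the recursion therefore says that \<open>c\<^sub>n\<close> is the sum of
  all \<open>A\<^sub>m\<^sub>r(X,\<dots>,X; c\<^sub>k\<^sub>1,\<dots>,c\<^sub>k\<^sub>r) / (m! r!)\<close> with \<open>m + k\<^sub>1 + \<dots> + k\<^sub>r = n\<close>
  (\<open>solution_term_expansion\<close>), which is the part of degree \<open>n\<close> of \<open>\<Psi>(X, \<Phi>(X))\<close>.

  All these terms are nonnegative, so partial sums are compared by comparing the index sets over which
  they range. Every nonzero term of \<open>S\<^sub>N\<^sub>+\<^sub>1\<close> occurs in the partial sum of order \<open>N + 1\<close> of \<open>\<Psi>(X, S\<^sub>N)\<close>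
  (\<open>partial_sum1_Suc_le\<close>), so by induction \<open>S\<^sub>N \<le> Y\<close> whenever \<open>\<Psi>(X, Y) \<le> Y\<close>. Conversely every term of a
  partial sum of \<open>\<Psi>(X, S\<^sub>N)\<close> occurs in some later \<open>S\<^sub>L\<close> (\<open>partial_sum2_le_partial_sum1\<close>), so by
  continuity for monotone convergence \<open>W = sup S\<^sub>N\<close> satisfies \<open>\<Psi>(X, W) \<le> W\<close>. The principal
  solution \<open>Z\<close> is a fixed point, for the same reason of continuity (\<open>principal_solution_exists\<close>), and lies
  below every \<open>Y\<close> with \<open>\<Psi>(X, Y) \<le> Y\<close> (\<open>iterate_le\<close>). Hence \<open>W \<le> Z \<le> W\<close>.

  The coefficients \<open>b\<^sub>n\<close> and \<open>B\<^sub>n\<close> arise from \<open>a\<close> and \<open>A\<close> by the same sums of substitutions, so the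
  majorization passes to them by induction on \<open>n\<close> (\<open>series_solution_majorant\<close>). The partial sums of
  \<open>\<phi>(x)\<close> then differ by no more than those of \<open>\<Phi>(X)\<close>, hence form a \<open>(bk)\<close>-fundamental sequence
  (\<open>majorized_series_converges\<close>).\<close>

section \<open>Monotone sequences in Riesz spaces\<close>

lemma increases_to_iff:
  "U \<up> V \<longleftrightarrow> incseq U \<and> (\<forall>p. U p \<le> V) \<and> (\<forall>w. (\<forall>p. U p \<le> w) \<longrightarrow> V \<le> w)"
  unfolding increases_to_def isLub_def leastP_def isUb_def setle_def setge_def by auto

lemma decreases_to_iff:
  "U \<down> V \<longleftrightarrow> decseq U \<and> (\<forall>p. V \<le> U p) \<and> (\<forall>w. (\<forall>p. w \<le> U p) \<longrightarrow> w \<le> V)"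
  unfolding decreases_to_def isGlb_def greatestP_def isLb_def setle_def setge_def by auto

lemma increases_to_incseq: "U \<up> V \<Longrightarrow> incseq U"
  and increases_to_upper: "U \<up> V \<Longrightarrow> U p \<le> V"
  and increases_to_least: "U \<up> V \<Longrightarrow> (\<And>p. U p \<le> w) \<Longrightarrow> V \<le> w"
  unfolding increases_to_iff by auto

lemma increases_to_unique: "U \<up> V \<Longrightarrow> U \<up> W \<Longrightarrow> V = W"
  by (meson increases_to_iff order_antisym)

lemma increases_to_const: "(\<lambda>_. c) \<up> c"
  unfolding increases_to_iff by (auto simp: incseq_def)

text \<open>Applied to sequences of this form, continuity for monotone convergence yields monotonicity.\<close>

lemma increases_to_step: "u \<le> v \<Longrightarrow> (\<lambda>p. if p = 0 then u else v) \<up> v"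
  unfolding increases_to_iff by (auto simp: incseq_def)

lemma increases_to_add:
  fixes u v :: "'a::riesz_space"
  assumes U: "U \<up> u" and V: "V \<up> v"
  shows "(\<lambda>p. U p + V p) \<up> (u + v)"
  unfolding increases_to_iff
proof (intro conjI allI impI)
  show "incseq (\<lambda>p. U p + V p)"
    using increases_to_incseq[OF U] increases_to_incseq[OF V]
    unfolding incseq_def by (simp add: add_mono)
  show "U p + V p \<le> u + v" for p
    using increases_to_upper[OF U] increases_to_upper[OF V] by (rule add_mono)
next
  fix w assume w: "\<forall>p. U p + V p \<le> w"
  \<comment> \<open>Separating the two indices allows the suprema to be taken one after the other.\<close>
  have "U p + V q \<le> w" for p q
  proof -
    have "U p \<le> U (max p q)" "V q \<le> V (max p q)"
      using U V unfolding increases_to_iff incseq_def by auto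
    then have "U p + V q \<le> U (max p q) + V (max p q)" by (rule add_mono)
    then show ?thesis using w order_trans by blast
  qed
  then have "U p \<le> w - V q" for p q by (simp add: le_diff_eq)
  then have "u \<le> w - V q" for q by (rule increases_to_least[OF U])
  then have "V q \<le> w - u" for q by (simp add: le_diff_eq add.commute)
  then have "v \<le> w - u" by (rule increases_to_least[OF V])
  then show "u + v \<le> w" by (simp add: le_diff_eq add.commute)
qed

lemma increases_to_scaleR:
  fixes u :: "'a::riesz_space"
  assumes U: "U \<up> u" and c: "0 \<le> c"
  shows "(\<lambda>p. c *\<^sub>R U p) \<up> (c *\<^sub>R u)"
proof (cases "c = 0")
  case True
  then show ?thesis by (simp add: increases_to_const)
next
  case False
  with c have c: "0 < c" by simp
  show ?thesis
    unfolding increases_to_iff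
  proof (intro conjI allI impI)
    show "incseq (\<lambda>p. c *\<^sub>R U p)"
      using U c unfolding increases_to_iff incseq_def by (auto intro: scaleR_left_mono)
    show "c *\<^sub>R U p \<le> c *\<^sub>R u" for p
      using U c unfolding increases_to_iff by (auto intro: scaleR_left_mono)
  next
    fix w assume "\<forall>p. c *\<^sub>R U p \<le> w"
    then have "(1 / c) *\<^sub>R (c *\<^sub>R U p) \<le> (1 / c) *\<^sub>R w" for p
      using c by (intro scaleR_left_mono) auto
    then have "U p \<le> (1 / c) *\<^sub>R w" for p using c by simp
    then have "u \<le> (1 / c) *\<^sub>R w" by (rule increases_to_least[OF U])
    then have "c *\<^sub>R u \<le> c *\<^sub>R ((1 / c) *\<^sub>R w)" using c by (intro scaleR_left_mono) auto
    then show "c *\<^sub>R u \<le> w" using c by simp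
  qed
qed

lemma increases_to_sum:
  fixes u :: "'i \<Rightarrow> 'a::riesz_space"
  assumes "\<And>i. i \<in> I \<Longrightarrow> U i \<up> u i"
  shows "(\<lambda>p. \<Sum>i\<in>I. U i p) \<up> (\<Sum>i\<in>I. u i)"
  using assms
proof (induction I rule: infinite_finite_induct)
  case (insert i I)
  then have "(\<lambda>p. U i p + (\<Sum>i\<in>I. U i p)) \<up> (u i + (\<Sum>i\<in>I. u i))"
    by (intro increases_to_add) auto
  then show ?case using insert.hyps by simp
next
  case (infinite I)
  show ?case unfolding sum.infinite[OF infinite(1)] by (rule increases_to_const)
qed (simp only: sum.empty increases_to_const)

lemma bounded_incseq_increases_to:
  fixes U :: "nat \<Rightarrow> 'a::sigma_complete_riesz_space"
  assumes "incseq U" "\<And>p. U p \<le> w"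
  obtains V where "U \<up> V"
proof -
  have "\<exists>s. (\<forall>x\<in>range U. x \<le> s) \<and> (\<forall>v. (\<forall>x\<in>range U. x \<le> v) \<longrightarrow> s \<le> v)"
    by (rule countable_sup_exists[where u = w]) (use assms in auto)
  then show ?thesis using that assms(1) unfolding increases_to_iff by blast
qed

lemma decreases_to_gap:
  fixes U :: "nat \<Rightarrow> 'a::riesz_space"
  assumes "U \<up> V"
  shows "(\<lambda>p. V - U p) \<down> 0"
  unfolding decreases_to_iff
proof (intro conjI allI impI)
  show "decseq (\<lambda>p. V - U p)"
    using assms unfolding increases_to_iff incseq_def decseq_def by (auto intro: diff_left_mono)
  show "0 \<le> V - U p" for p using increases_to_upper[OF assms] by simp
next
  fix w assume "\<forall>p. w \<le> V - U p"
  then have "U p \<le> V - w" for p by (simp add: le_diff_eq add.commute)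
  then have "V \<le> V - w" by (rule increases_to_least[OF assms])
  then show "w \<le> 0" by (simp add: le_diff_eq)
qed

lemma increases_to_o_converges:
  assumes "U \<up> V"
  shows "o_converges U V"
  unfolding o_converges_def
proof (intro exI conjI allI)
  show "(\<lambda>p. V - U p) \<down> 0" by (rule decreases_to_gap[OF assms])
  show "\<bar>U p - V\<bar> \<le> V - U p" for p
    using increases_to_upper[OF assms, of p]
    by (intro abs_leI) (auto intro: order_trans[of _ 0])
qed

text \<open>For increasing sequences \<open>(o)\<close>-convergence and convergence to the supremum agree, so the \<open>(o)\<close>-sums of
  nonnegative terms can be handled as suprema throughout; uniqueness of the \<open>(o)\<close>-limit comes for free.\<close>

lemma incseq_o_converges:
  assumes inc: "incseq U" and conv: "o_converges U V"
  shows "U \<up> V"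
proof -
  obtain \<epsilon> where \<epsilon>: "\<epsilon> \<down> 0" and bd: "\<And>p. \<bar>U p - V\<bar> \<le> \<epsilon> p"
    using conv unfolding o_converges_def by blast
  have up: "U p - V \<le> \<epsilon> p" and lo: "V - U p \<le> \<epsilon> p" for p
    using abs_le_D1[OF bd] abs_le_D2[OF bd] by auto
  have inf: "w \<le> 0" if "\<And>p. w \<le> \<epsilon> p" for w
    using \<epsilon> that unfolding decreases_to_iff by blast
  \<comment> \<open>The error bound at a late index also controls the excess at every earlier one.\<close>
  have "U p - V \<le> \<epsilon> q" for p q
  proof -
    have "U p - V \<le> U (max p q) - V" using inc unfolding incseq_def by (auto intro: diff_right_mono)
    also have "\<dots> \<le> \<epsilon> (max p q)" by (rule up)
    also have "\<dots> \<le> \<epsilon> q" using \<epsilon> unfolding decreases_to_iff decseq_def by auto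
    finally show ?thesis .
  qed
  then have "U p \<le> V" for p using inf[of "U p - V"] by simp
  moreover have "V \<le> w" if "\<And>p. U p \<le> w" for w
  proof -
    have "V - w \<le> \<epsilon> p" for p using diff_left_mono[OF that[of p], of V] lo[of p] by (rule order_trans)
    then show ?thesis using inf[of "V - w"] by simp
  qed
  ultimately show ?thesis using inc unfolding increases_to_iff by blast
qed

lemma o_lim_eqI:
  assumes "U \<up> V"
  shows "o_lim U = V"
  unfolding o_lim_def
proof (rule the_equality)
  show "o_converges U V" by (rule increases_to_o_converges[OF assms])
  show "W = V" if "o_converges U W" for W
    using incseq_o_converges[OF increases_to_incseq[OF assms] that] assms increases_to_unique
    by blast
qed


section \<open>Majorant series and the principal solution\<close>

locale positive_series =
  fixes A :: "'p::riesz_space list \<Rightarrow> 'q::riesz_space list \<Rightarrow> 'q"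
  assumes multilin: "multilinear (*\<^sub>R) (*\<^sub>R) A"
    and symmetrical: "completely_symmetrical A"
    and continuous: "continuous_monotone A"
    and no_linear_term: "A [] [Y] = 0"
    and nonneg: "Xs \<noteq> [] \<or> Ys \<noteq> [] \<Longrightarrow> \<forall>X\<in>set Xs. 0 \<le> X \<Longrightarrow> \<forall>Y\<in>set Ys. 0 \<le> Y \<Longrightarrow> 0 \<le> A Xs Ys"
begin

lemma partial_sum2_nonneg:
  assumes "0 \<le> X" "0 \<le> Y"
  shows "0 \<le> partial_sum2 (*\<^sub>R) A X Y N"
  unfolding partial_sum2_def
  by (rule sum_nonneg) (use assms in \<open>auto intro!: scaleR_nonneg_nonneg nonneg\<close>)

lemma finite_degrees: "finite {(m, n). 1 \<le> m + n \<and> m + n \<le> (N::nat)}"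
  by (rule finite_subset[of _ "{..N} \<times> {..N}"]) auto

lemma incseq_partial_sum2:
  assumes "0 \<le> X" "0 \<le> Y"
  shows "incseq (partial_sum2 (*\<^sub>R) A X Y)"
  unfolding incseq_def partial_sum2_def
proof (intro allI impI)
  fix M N :: nat assume "M \<le> N"
  then show "(\<Sum>(m, n) | 1 \<le> m + n \<and> m + n \<le> M. (1 / (fact m * fact n)) *\<^sub>R A (replicate m X) (replicate n Y))
    \<le> (\<Sum>(m, n) | 1 \<le> m + n \<and> m + n \<le> N. (1 / (fact m * fact n)) *\<^sub>R A (replicate m X) (replicate n Y))"
    using assms by (intro sum_mono2[OF finite_degrees]) (auto intro!: scaleR_nonneg_nonneg nonneg)
qed

lemma partial_sum2_increases_to:
  assumes X: "0 \<le> X" and V: "\<And>p. 0 \<le> V p" "V \<up> Y"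
  shows "(\<lambda>p. partial_sum2 (*\<^sub>R) A X (V p) N) \<up> partial_sum2 (*\<^sub>R) A X Y N"
proof -
  have "(\<lambda>p. A (replicate m X) (replicate n (V p))) \<up> A (replicate m X) (replicate n Y)"
    if "1 \<le> m + n" for m n
  proof -
    have ne: "0 < m \<or> 0 < n" using that by auto
    have "(\<lambda>p. A (map (\<lambda>U. U p) (replicate m (\<lambda>_. X))) (map (\<lambda>V. V p) (replicate n V)))
      \<up> A (replicate m X) (replicate n Y)"
      using continuous[unfolded continuous_monotone_def, rule_format,
          of "replicate m (\<lambda>_. X)" "replicate n V" "replicate m X" "replicate n Y"]
        ne X V by (auto simp: list_all2_conv_all_nth increases_to_const)
    then show ?thesis by simp
  qed
  then show ?thesis
    unfolding partial_sum2_def case_prod_beta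
    by (intro increases_to_sum increases_to_scaleR) auto
qed

lemma partial_sum2_mono:
  assumes "0 \<le> X" "0 \<le> V" "V \<le> W"
  shows "partial_sum2 (*\<^sub>R) A X V N \<le> partial_sum2 (*\<^sub>R) A X W N"
proof -
  have "0 \<le> (if p = 0 then V else W)" for p :: nat using assms by auto
  from increases_to_upper[OF partial_sum2_increases_to[OF assms(1) this increases_to_step[OF assms(3)]], of 0 N]
  show ?thesis by simp
qed

end

locale convergent_positive_series = positive_series A
  for A :: "'p::riesz_space list \<Rightarrow> 'q::sigma_complete_riesz_space list \<Rightarrow> 'q" +
  fixes E :: "('p \<times> 'q) set"
  assumes star: "order_star E"
    and converges: "(X, Y) \<in> E \<Longrightarrow> \<exists>Z. o_converges (partial_sum2 (*\<^sub>R) A X Y) Z"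
begin

lemma star_nonneg: "(X, Y) \<in> E \<Longrightarrow> 0 \<le> X \<and> 0 \<le> Y"
proof -
  assume "(X, Y) \<in> E"
  then have "(X, Y) \<in> {0..}" using star unfolding order_star_def by (rule subsetD[OF conjunct1, rotated])
  then show ?thesis by (simp add: less_eq_prod_def)
qed

lemma star_below: "(X, Y) \<in> E \<Longrightarrow> 0 \<le> V \<Longrightarrow> V \<le> Y \<Longrightarrow> (X, V) \<in> E"
proof -
  assume XY: "(X, Y) \<in> E" and V: "0 \<le> V" "V \<le> Y"
  have "(X, V) \<in> {0..(X, Y)}" using V star_nonneg[OF XY] by (simp add: less_eq_prod_def)
  then show ?thesis using star XY unfolding order_star_def by blast
qed

lemma Psi_increases_to:
  assumes "(X, Y) \<in> E"
  shows "partial_sum2 (*\<^sub>R) A X Y \<up> Psi A X Y"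
proof -
  obtain Z where "o_converges (partial_sum2 (*\<^sub>R) A X Y) Z" using converges[OF assms] by blast
  then have Z: "partial_sum2 (*\<^sub>R) A X Y \<up> Z"
    using incseq_o_converges incseq_partial_sum2 star_nonneg[OF assms] by blast
  then show ?thesis unfolding Psi_def o_lim_eqI[OF Z] .
qed

lemma Psi_nonneg:
  assumes "(X, Y) \<in> E"
  shows "0 \<le> Psi A X Y"
  using partial_sum2_nonneg[of X Y 0] increases_to_upper[OF Psi_increases_to[OF assms], of 0]
    star_nonneg[OF assms] by (auto intro: order_trans)

lemma Psi_mono:
  assumes E: "(X, W) \<in> E" and V: "0 \<le> V" "V \<le> W"
  shows "Psi A X V \<le> Psi A X W"
proof (rule increases_to_least[OF Psi_increases_to[OF star_below[OF E V]]])
  fix N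
  have "partial_sum2 (*\<^sub>R) A X V N \<le> partial_sum2 (*\<^sub>R) A X W N"
    using V star_nonneg[OF E] by (intro partial_sum2_mono) auto
  also have "\<dots> \<le> Psi A X W" by (rule increases_to_upper[OF Psi_increases_to[OF E]])
  finally show "partial_sum2 (*\<^sub>R) A X V N \<le> Psi A X W" .
qed

text \<open>\<open>\<Psi>\<close> inherits continuity for monotone convergence from its terms: a finite partial sum at the supremum
  \<open>Z\<close> is itself the supremum of its values along \<open>V\<close>, so the suprema over the order and over the
  sequence may be interchanged. This applies to the iterates, where the finite partial sums lie below
  the next iterate, and to the
  partial sums of the formal solution, where they lie below later partial sums.\<close>

lemma Psi_sup_le:
  assumes E: "(X, Z) \<in> E" and V: "\<And>p. 0 \<le> V p" "V \<up> Z"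
    and le: "\<And>p N. partial_sum2 (*\<^sub>R) A X (V p) N \<le> W"
  shows "Psi A X Z \<le> W"
proof (rule increases_to_least[OF Psi_increases_to[OF E]])
  show "partial_sum2 (*\<^sub>R) A X Z N \<le> W" for N
    using le by (intro increases_to_least[OF partial_sum2_increases_to[OF _ V]])
      (use star_nonneg[OF E] in auto)
qed

text \<open>The iterates start below every supersolution \<open>Y\<close>, and \<open>\<Psi>(X, \<cdot>)\<close> keeps them there. So the principal
  solution, once it exists, is the least supersolution.\<close>

lemma iterate_le:
  assumes E: "(X, Y) \<in> E" and Y: "Psi A X Y \<le> Y"
  shows "0 \<le> iterate A X p \<and> iterate A X p \<le> Y"
proof (induction p)
  case 0
  then show ?case using star_nonneg[OF E] by (simp add: iterate_def)
next
  case (Suc p)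
  then have "(X, iterate A X p) \<in> E" using star_below[OF E] by blast
  moreover have "Psi A X (iterate A X p) \<le> Psi A X Y" using Suc Psi_mono[OF E] by blast
  ultimately show ?case using Psi_nonneg Y by (auto simp: iterate_def)
qed

lemma principal_solution_exists:
  assumes E: "(X, Y) \<in> E" and Y: "Psi A X Y \<le> Y"
  obtains Z where "iterate A X \<up> Z" "(X, Z) \<in> E" "Psi A X Z = Z"
proof -
  note bd = iterate_le[OF E Y]
  have inE: "(X, iterate A X p) \<in> E" for p using bd star_below[OF E] by blast
  have step: "iterate A X (Suc p) = Psi A X (iterate A X p)" for p by (simp add: iterate_def)
  have "iterate A X p \<le> iterate A X (Suc p)" for p
  proof (induction p)
    case 0
    then show ?case using bd[of "Suc 0"] by (simp add: iterate_def)
  next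
    case (Suc p)
    then show ?case unfolding step[of "Suc p"] step[of p, symmetric]
      by (metis step Psi_mono bd inE)
  qed
  then have "incseq (iterate A X)" by (rule incseq_SucI)
  then obtain Z where Z: "iterate A X \<up> Z"
    using bd by (blast intro: bounded_incseq_increases_to)
  have Z0: "0 \<le> Z" using bd[of 0] increases_to_upper[OF Z, of 0] by auto
  have "Z \<le> Y" using bd by (intro increases_to_least[OF Z]) auto
  then have EZ: "(X, Z) \<in> E" using star_below[OF E Z0] by blast
  have "Psi A X Z \<le> Z"
  proof (rule Psi_sup_le[OF EZ _ Z])
    show "0 \<le> iterate A X p" for p using bd by blast
    show "partial_sum2 (*\<^sub>R) A X (iterate A X p) N \<le> Z" for p N
      using increases_to_upper[OF Psi_increases_to[OF inE[of p]], of N]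
        increases_to_upper[OF Z, of "Suc p"] unfolding step by (rule order_trans)
  qed
  moreover have "Z \<le> Psi A X Z"
  proof (rule increases_to_least[OF Z])
    fix p
    show "iterate A X p \<le> Psi A X Z"
    proof (cases p)
      case 0
      then show ?thesis using Psi_nonneg[OF EZ] by (simp add: iterate_def)
    next
      case (Suc q)
      then show ?thesis using Psi_mono[OF EZ] bd increases_to_upper[OF Z] by (simp add: step)
    qed
  qed
  ultimately show ?thesis using that Z EZ by auto
qed

lemma Delta1_eq_Gamma1: "Delta1 A E = Gamma1 A E"
proof
  show "Delta1 A E \<subseteq> Gamma1 A E"
  proof
    fix X assume "X \<in> Delta1 A E"
    then obtain Y where "(X, Y) \<in> E" "Psi A X Y \<le> Y" unfolding Delta1_def by blast
    then obtain Z where "(X, Z) \<in> E" "Psi A X Z = Z" by (rule principal_solution_exists)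
    then show "X \<in> Gamma1 A E" using star_nonneg[of X Z] unfolding Gamma1_def by auto
  qed
  show "Gamma1 A E \<subseteq> Delta1 A E" unfolding Gamma1_def Delta1_def by auto
qed

end

section \<open>Set partitions and compositions\<close>

text \<open>Sizes of blocks are recorded as compositions. Listing the blocks in order makes the multinomial count
  a recursion on the first block; the \<open>r!\<close> orders of an unordered partition are divided out afterwards.\<close>

definition compositions :: "nat \<Rightarrow> nat list set" where
  "compositions n = {ks. 0 \<notin> set ks \<and> sum_list ks = n}"

definition ordered_partitions :: "'a set \<Rightarrow> 'a set list set" where
  "ordered_partitions U = {Ss. distinct Ss \<and> partition_on U (set Ss)}"

lemma length_le_sum_list: "0 \<notin> set ks \<Longrightarrow> length ks \<le> sum_list (ks :: nat list)"
  by (induction ks) auto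

lemma finite_compositions: "finite (compositions n)"
proof (rule finite_subset)
  show "compositions n \<subseteq> {ks. set ks \<subseteq> {..n} \<and> length ks \<le> n}"
    unfolding compositions_def using length_le_sum_list member_le_sum_list by fastforce
qed (rule finite_lists_length_le, simp)

lemma compositions_0: "compositions 0 = {[]}"
  unfolding compositions_def by (auto simp del: sum_list_eq_0_iff dest: length_le_sum_list)

lemma compositions_Cons:
  assumes "0 < n"
  shows "compositions n = (\<lambda>(k, ks). k # ks) ` (SIGMA k:{1..n}. compositions (n - k))"
proof (rule set_eqI)
  fix ls
  show "ls \<in> compositions n \<longleftrightarrow> ls \<in> (\<lambda>(k, ks). k # ks) ` (SIGMA k:{1..n}. compositions (n - k))"
    using assms by (cases ls) (auto simp: compositions_def image_iff)
qed

lemma ordered_partitions_empty: "ordered_partitions {} = {[]}"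
  unfolding ordered_partitions_def by (auto simp: partition_on_empty)

lemma ordered_partitions_Cons:
  assumes "U \<noteq> {}"
  shows "ordered_partitions U
    = (\<lambda>(S, Ss). S # Ss) ` (SIGMA S:Pow U - {{}}. ordered_partitions (U - S))"
proof (rule set_eqI)
  fix Ts
  show "Ts \<in> ordered_partitions U
    \<longleftrightarrow> Ts \<in> (\<lambda>(S, Ss). S # Ss) ` (SIGMA S:Pow U - {{}}. ordered_partitions (U - S))"
  proof (cases Ts)
    case Nil
    then show ?thesis using assms by (auto simp: ordered_partitions_def partition_on_def)
  next
    case (Cons S Ss)
    have "distinct (S # Ss) \<and> partition_on U (set (S # Ss))
      \<longleftrightarrow> S \<subseteq> U \<and> S \<noteq> {} \<and> distinct Ss \<and> partition_on (U - S) (set Ss)" (is "?L \<longleftrightarrow> ?R")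
    proof
      assume L: ?L
      then have "disjnt S (\<Union>(set Ss))"
        by (auto simp: partition_on_def pairwise_insert disjnt_iff)
      from partition_on_insert[OF this] L show ?R by auto
    next
      assume R: ?R
      then have dj: "disjnt S (\<Union>(set Ss))"
        by (auto simp: partition_on_def disjnt_iff)
      with R have "S \<notin> set Ss" by (auto simp: disjnt_iff)
      with partition_on_insert[OF dj] R show ?L by auto
    qed
    then show ?thesis using Cons by (auto simp: ordered_partitions_def image_iff)
  qed
qed

lemma sum_over_subsets:
  fixes g :: "nat \<Rightarrow> 'v::real_vector"
  assumes "finite U" "finite K"
  shows "(\<Sum>S | S \<subseteq> U \<and> card S \<in> K. g (card S)) = (\<Sum>k\<in>K. real (card U choose k) *\<^sub>R g k)"
proof -
  let ?S = "{S. S \<subseteq> U \<and> card S \<in> K}"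
  have "(\<Sum>S\<in>?S. g (card S)) = (\<Sum>k\<in>K. \<Sum>S | S \<in> ?S \<and> card S = k. g (card S))"
    by (rule sum.group[symmetric]) (use assms in auto)
  also have "\<dots> = (\<Sum>k\<in>K. real (card U choose k) *\<^sub>R g k)"
  proof (rule sum.cong[OF refl])
    fix k assume "k \<in> K"
    then have "{S. S \<in> ?S \<and> card S = k} = {S. S \<subseteq> U \<and> card S = k}" by auto
    then have "(\<Sum>S | S \<in> ?S \<and> card S = k. g (card S)) = (\<Sum>S | S \<subseteq> U \<and> card S = k. g k)"
      by simp
    also have "\<dots> = real (card U choose k) *\<^sub>R g k"
      by (simp add: sum_constant_scaleR n_subsets[OF assms(1)])
    finally show "(\<Sum>S | S \<in> ?S \<and> card S = k. g (card S)) = real (card U choose k) *\<^sub>R g k" .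
  qed
  finally show ?thesis .
qed

lemma finite_ordered_partitions: "finite U \<Longrightarrow> finite (ordered_partitions U)"
proof (rule finite_subset)
  assume "finite U"
  then show "finite (\<Union>P\<in>{P. partition_on U P}. permutations_of_set P)"
    by (intro finite_UN_I finitely_many_partition_on) auto
  show "ordered_partitions U \<subseteq> (\<Union>P\<in>{P. partition_on U P}. permutations_of_set P)"
    unfolding ordered_partitions_def by auto
qed

text \<open>The multinomial count, by splitting off the first block \<open>S\<close>: there are \<open>n choose k\<close> sets \<open>S\<close> of size \<open>k\<close>, and
  \<open>(n choose k) (n - k)! = n! / k!\<close>. It is stated with an arbitrary weight \<open>h\<close> because the induction changes
  the weight to \<open>\<lambda>ks. h (k # ks)\<close>.\<close>

lemma sum_over_ordered_partitions:
  fixes h :: "nat list \<Rightarrow> 'v::real_vector"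
  assumes "finite U"
  shows "(\<Sum>Ss\<in>ordered_partitions U. h (map card Ss))
    = (\<Sum>ks\<in>compositions (card U). (fact (card U) / (\<Prod>k\<leftarrow>ks. fact k)) *\<^sub>R h ks)"
  using assms
proof (induction U arbitrary: h rule: finite_psubset_induct)
  case (psubset U)
  show ?case
  proof (cases "U = {}")
    case True
    then show ?thesis by (simp add: ordered_partitions_empty compositions_0)
  next
    case False
    let ?n = "card U"
    let ?F = "\<lambda>ks. \<Prod>k\<leftarrow>ks. fact k :: real"
    have n: "0 < ?n" using False psubset.hyps by auto
    define g where "g = (\<lambda>k. \<Sum>ks\<in>compositions (?n - k). (fact (?n - k) / ?F ks) *\<^sub>R h (k # ks))"
    have sets: "Pow U - {{}} = {S. S \<subseteq> U \<and> card S \<in> {1..?n}}"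
      using psubset.hyps card_mono[OF psubset.hyps] finite_subset[OF _ psubset.hyps]
      by (auto simp: Suc_le_eq card_gt_0_iff)
    have "(\<Sum>Ss\<in>ordered_partitions U. h (map card Ss))
      = (\<Sum>(S, Ss)\<in>(SIGMA S:Pow U - {{}}. ordered_partitions (U - S)). h (card S # map card Ss))"
      unfolding ordered_partitions_Cons[OF False]
      by (subst sum.reindex) (auto simp: inj_on_def o_def case_prod_beta)
    also have "\<dots> = (\<Sum>S\<in>Pow U - {{}}. \<Sum>Ss\<in>ordered_partitions (U - S). h (card S # map card Ss))"
      using psubset.hyps by (subst sum.Sigma) (auto intro: finite_ordered_partitions)
    also have "\<dots> = (\<Sum>S\<in>Pow U - {{}}. g (card S))"
    proof (rule sum.cong[OF refl])
      fix S assume S: "S \<in> Pow U - {{}}"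
      then have "U - S \<subset> U" "card (U - S) = ?n - card S"
        using psubset.hyps by (auto simp: card_Diff_subset finite_subset)
      then show "(\<Sum>Ss\<in>ordered_partitions (U - S). h (card S # map card Ss)) = g (card S)"
        using psubset.IH[of "U - S" "\<lambda>ks. h (card S # ks)"] by (simp add: g_def)
    qed
    also have "\<dots> = (\<Sum>k\<in>{1..?n}. real (?n choose k) *\<^sub>R g k)"
      unfolding sets by (rule sum_over_subsets[OF psubset.hyps]) simp
    also have "\<dots> = (\<Sum>k\<in>{1..?n}. \<Sum>ks\<in>compositions (?n - k). (fact ?n / ?F (k # ks)) *\<^sub>R h (k # ks))"
      by (auto simp: g_def scaleR_sum_right binomial_fact intro!: sum.cong)
    also have "\<dots> = (\<Sum>(k, ks)\<in>(SIGMA k:{1..?n}. compositions (?n - k)).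
        (fact ?n / ?F (k # ks)) *\<^sub>R h (k # ks))"
      by (rule sum.Sigma) (auto intro: finite_compositions)
    also have "\<dots> = (\<Sum>ks\<in>compositions ?n. (fact ?n / ?F ks) *\<^sub>R h ks)"
      unfolding compositions_Cons[OF n]
      by (subst sum.reindex) (auto simp: inj_on_def o_def case_prod_beta)
    finally show ?thesis .
  qed
qed

text \<open>Symmetry of \<open>g\<close> makes the order chosen by \<open>blocks\<close> immaterial, so each partition may be replaced by the
  average over its \<open>r!\<close> listings, and these together are exactly the ordered partitions.\<close>

lemma sum_over_partitions:
  fixes g :: "nat list \<Rightarrow> 'v::real_vector"
  assumes U: "finite U" and sym: "\<And>ks ls. mset ks = mset ls \<Longrightarrow> g ks = g ls"
  shows "(\<Sum>P | partition_on U P. g (map card (blocks P)))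
    = (\<Sum>ks\<in>compositions (card U).
        (fact (card U) / (fact (length ks) * (\<Prod>k\<leftarrow>ks. fact k))) *\<^sub>R g ks)"
proof -
  have fin: "finite P" if "partition_on U P" for P
    using that U finite_elements by blast
  have "(\<Sum>P | partition_on U P. g (map card (blocks P)))
    = (\<Sum>P | partition_on U P. \<Sum>Ss\<in>permutations_of_set P. (1 / fact (length Ss)) *\<^sub>R g (map card Ss))"
  proof (rule sum.cong[OF refl])
    fix P assume "P \<in> {P. partition_on U P}"
    then have P: "partition_on U P" by simp
    have "(1 / fact (length Ss)) *\<^sub>R g (map card Ss) = (1 / fact (card P)) *\<^sub>R g (map card (blocks P))"
      if "Ss \<in> permutations_of_set P" for Ss
    proof -
      have Ss: "set Ss = P" "distinct Ss" using permutations_of_setD[OF that] by auto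
      then have "mset Ss = mset (blocks P)"
        by (subst set_eq_iff_mset_eq_distinct[symmetric])
          (auto simp: set_blocks[OF P U] distinct_blocks[OF P U])
      then have "g (map card Ss) = g (map card (blocks P))" by (intro sym) simp
      then show ?thesis using Ss distinct_card by fastforce
    qed
    then show "g (map card (blocks P))
      = (\<Sum>Ss\<in>permutations_of_set P. (1 / fact (length Ss)) *\<^sub>R g (map card Ss))"
      by (simp add: fin[OF P] sum_constant_scaleR)
  qed
  also have "\<dots> = (\<Sum>Ss\<in>(\<Union>P\<in>{P. partition_on U P}. permutations_of_set P).
      (1 / fact (length Ss)) *\<^sub>R g (map card Ss))"
    by (rule sum.UNION_disjoint[symmetric])
      (auto simp: finitely_many_partition_on[OF U] dest: permutations_of_setD)
  also have "(\<Union>P\<in>{P. partition_on U P}. permutations_of_set P) = ordered_partitions U"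
    unfolding ordered_partitions_def by (auto dest: permutations_of_setD)
  also have "(\<Sum>Ss\<in>ordered_partitions U. (1 / fact (length Ss)) *\<^sub>R g (map card Ss))
    = (\<Sum>ks\<in>compositions (card U).
        (fact (card U) / (fact (length ks) * (\<Prod>k\<leftarrow>ks. fact k))) *\<^sub>R g ks)"
    using sum_over_ordered_partitions[OF U, of "\<lambda>ks. (1 / fact (length ks)) *\<^sub>R g ks"]
    by (simp add: mult.commute)
  finally show ?thesis .
qed

section \<open>Cauchy majorants of formal solutions\<close>

text \<open>The coefficient at the pair of empty lists is not constrained by the hypotheses on \<open>a\<close> and \<open>A\<close>. The recursion
  never reaches it: a nonempty list is split into a nonempty collection of nonempty parts.\<close>

lemma block_facts:
  assumes M: "M \<subseteq> {..<length xs}" and P: "partition_on ({..<length xs} - M) P"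
    and ne: "P \<noteq> {{..<length xs}}" and xs: "xs \<noteq> []"
  shows "nths xs M \<noteq> [] \<or> blocks P \<noteq> []"
    and "S \<in> set (blocks P) \<Longrightarrow> nths xs S \<noteq> [] \<and> length (nths xs S) < length xs"
proof -
  have set: "set (blocks P) = P" by (rule set_blocks[OF P]) simp
  have nths_ne: "nths xs T \<noteq> []" if T: "T \<subseteq> {..<length xs}" "T \<noteq> {}" for T
  proof -
    have "{i. i < length xs \<and> i \<in> T} = T" using T by auto
    then have "length (nths xs T) = card T" by (simp add: length_nths)
    moreover have "0 < card T" using T finite_subset[OF T(1)] by (simp add: card_gt_0_iff)
    ultimately show ?thesis by auto
  qed
  show "nths xs M \<noteq> [] \<or> blocks P \<noteq> []"
  proof (cases "M = {}")
    case True
    then have "\<Union>P \<noteq> {}" using xs unfolding partition_onD1[OF P, symmetric] by (auto simp: lessThan_empty_iff)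
    then show ?thesis using set by auto
  next
    case False
    then show ?thesis using nths_ne[OF M] by blast
  qed
  assume S: "S \<in> set (blocks P)"
  then have "S \<in> P" by (simp add: set)
  then have "S \<subseteq> {..<length xs}" "S \<noteq> {}"
    using partition_onD1[OF P] partition_onD3[OF P] by auto
  then show "nths xs S \<noteq> [] \<and> length (nths xs S) < length xs"
    using nths_ne length_nths_block[OF P ne S] by blast
qed

lemma list_all2_nths:
  assumes "list_all2 R xs ys"
  shows "list_all2 R (nths xs I) (nths ys I)"
  using assms by (induction arbitrary: I) (auto simp: nths_Cons)

lemma series_solution_nonneg:
  fixes A :: "'p::{zero, order} list \<Rightarrow> 'q::ordered_comm_monoid_add list \<Rightarrow> 'q"
  assumes nonneg: "\<And>Xs Ys. Xs \<noteq> [] \<or> Ys \<noteq> [] \<Longrightarrow> \<forall>X\<in>set Xs. 0 \<le> X \<Longrightarrow> \<forall>Y\<in>set Ys. 0 \<le> Y \<Longrightarrow> 0 \<le> A Xs Ys"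
    and "Xs \<noteq> []" "\<forall>X\<in>set Xs. 0 \<le> X"
  shows "0 \<le> series_solution A Xs"
  using assms(2,3)
proof (induction Xs rule: length_induct)
  case (1 Xs)
  show ?case
    unfolding series_solution.simps[of A Xs]
  proof (intro sum_nonneg nonneg)
    fix M P
    assume "M \<in> Pow {..<length Xs}" "P \<in> {P. partition_on ({..<length Xs} - M) P \<and> P \<noteq> {{..<length Xs}}}"
    then have MP: "M \<subseteq> {..<length Xs}" "partition_on ({..<length Xs} - M) P" "P \<noteq> {{..<length Xs}}"
      by auto
    note facts = block_facts[OF MP 1(2)]
    show "nths Xs M \<noteq> [] \<or> map (\<lambda>S. series_solution A (nths Xs S)) (blocks P) \<noteq> []"
      using facts(1) by simp
    show "\<forall>X\<in>set (nths Xs M). 0 \<le> X" using 1(3) by (auto dest: in_set_nthsD)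
    have "0 \<le> series_solution A (nths Xs S)" if "S \<in> set (blocks P)" for S
    proof -
      have "\<forall>X\<in>set (nths Xs S). 0 \<le> X" using 1(3) by (auto dest: in_set_nthsD)
      then show ?thesis using 1(1) facts(2)[OF that] by blast
    qed
    then show "\<forall>Y\<in>set (map (\<lambda>S. series_solution A (nths Xs S)) (blocks P)). 0 \<le> Y" by auto
  qed
qed

context lattice_normed_space
begin

lemma nrm_zero: "nrm 0 = 0"
  using nrm_scale[of 0 0] by simp

lemma nrm_diff_commute: "nrm (x - y) = nrm (y - x)"
  using nrm_scale[of "- 1" "x - y"] by (simp add: scale_minus_left)

lemma nrm_sum_le: "(\<And>i. i \<in> I \<Longrightarrow> nrm (u i) \<le> c i) \<Longrightarrow> nrm (sum u I) \<le> sum c I"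
proof (induction I rule: infinite_finite_induct)
  case (insert i I)
  have "nrm (u i + sum u I) \<le> nrm (u i) + nrm (sum u I)" by (rule nrm_triangle)
  also have "\<dots> \<le> c i + sum c I" using insert by (intro add_mono) auto
  finally show ?case using insert.hyps by simp
qed (simp_all add: nrm_zero)

end

text \<open>Both recursions run over the same sets \<open>M\<close> and the same lists of blocks, since these depend only on the length
  of the argument; so the norm estimate can be made term by term.\<close>

lemma series_solution_majorant:
  fixes normX :: "'x \<Rightarrow> 'p::{zero, order}" and normY :: "'y::ab_group_add \<Rightarrow> 'q::riesz_space"
    and scaleY :: "'k::real_normed_field \<Rightarrow> 'y \<Rightarrow> 'y"
  assumes Y: "lattice_normed_space scaleY normY" and maj: "majorant2 normX normY a A"
  shows "majorant1 normX normY (series_solution a) (series_solution A)"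
proof -
  have nonneg: "\<And>Xs Ys. Xs \<noteq> [] \<or> Ys \<noteq> [] \<Longrightarrow> \<forall>X\<in>set Xs. 0 \<le> X \<Longrightarrow> \<forall>Y\<in>set Ys. 0 \<le> Y \<Longrightarrow> 0 \<le> A Xs Ys"
    and bound: "\<And>xs Xs ys Ys. xs \<noteq> [] \<or> ys \<noteq> [] \<Longrightarrow> list_all2 (\<lambda>x X. normX x \<le> X) xs Xs \<Longrightarrow>
      list_all2 (\<lambda>y Y. normY y \<le> Y) ys Ys \<Longrightarrow> normY (a xs ys) \<le> A Xs Ys"
    using maj unfolding majorant2_def by blast+
  have "normY (series_solution a xs) \<le> series_solution A Xs"
    if "xs \<noteq> []" "list_all2 (\<lambda>x X. normX x \<le> X) xs Xs" for xs Xs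
    using that
  proof (induction xs arbitrary: Xs rule: length_induct)
    case (1 xs)
    have len: "length Xs = length xs" using list_all2_lengthD[OF 1(3)] by simp
    show ?case
      unfolding series_solution.simps[of a xs] series_solution.simps[of A Xs] len
    proof (intro lattice_normed_space.nrm_sum_le[OF Y] bound)
      fix M P
      assume "M \<in> Pow {..<length xs}" "P \<in> {P. partition_on ({..<length xs} - M) P \<and> P \<noteq> {{..<length xs}}}"
      then have MP: "M \<subseteq> {..<length xs}" "partition_on ({..<length xs} - M) P" "P \<noteq> {{..<length xs}}"
        by auto
      note facts = block_facts[OF MP 1(2)]
      show "nths xs M \<noteq> [] \<or> map (\<lambda>S. series_solution a (nths xs S)) (blocks P) \<noteq> []"
        using facts(1) by simp
      show "list_all2 (\<lambda>x X. normX x \<le> X) (nths xs M) (nths Xs M)"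
        by (rule list_all2_nths[OF 1(3)])
      have "normY (series_solution a (nths xs S)) \<le> series_solution A (nths Xs S)"
        if "S \<in> set (blocks P)" for S
        using 1(1) facts(2)[OF that] list_all2_nths[OF 1(3), of S] by blast
      then show "list_all2 (\<lambda>y Y. normY y \<le> Y)
          (map (\<lambda>S. series_solution a (nths xs S)) (blocks P))
          (map (\<lambda>S. series_solution A (nths Xs S)) (blocks P))"
        by (auto simp: list_all2_conv_all_nth)
    qed
  qed
  then show ?thesis
    unfolding majorant1_def using series_solution_nonneg[of A] nonneg by blast
qed


section \<open>The formal solution as a sum over compositions\<close>

lemma nths_replicate:
  assumes "M \<subseteq> {..<n}"
  shows "nths (replicate n x) M = replicate (card M) x"
proof (rule replicate_eqI)
  have "{i. i < n \<and> i \<in> M} = M" using assms by auto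
  then show "length (nths (replicate n x) M) = card M" by (simp add: length_nths)
  show "y = x" if "y \<in> set (nths (replicate n x) M)" for y
    using in_set_nthsD[OF that] by simp
qed

context positive_series
begin

lemma linear_slot: "module_hom (*\<^sub>R) (*\<^sub>R) (\<lambda>y. A xs (pre @ y # post))"
proof -
  have "length pre < length (pre @ 0 # post)" by simp
  then have "Vector_Spaces.linear (*\<^sub>R) (*\<^sub>R) (\<lambda>y. A xs ((pre @ 0 # post)[length pre := y]))"
    using multilin unfolding multilinear_def by blast
  then show ?thesis by (simp add: module_hom_eq_linear)
qed

lemma slot_scale: "A xs (pre @ (c *\<^sub>R y) # post) = c *\<^sub>R A xs (pre @ y # post)"
  using module_hom.scale[OF linear_slot[of xs pre post]] .

lemma slot_sum: "A xs (pre @ (\<Sum>i\<in>I. v i) # post) = (\<Sum>i\<in>I. A xs (pre @ v i # post))"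
  using module_hom.sum[OF linear_slot[of xs pre post]] .

lemma slots_scale:
  "A xs (pre @ map (\<lambda>k. f k *\<^sub>R v k) ks) = (\<Prod>k\<leftarrow>ks. f k) *\<^sub>R A xs (pre @ map v ks)"
proof (induction ks arbitrary: pre)
  case (Cons k ks)
  have "A xs (pre @ map (\<lambda>k. f k *\<^sub>R v k) (k # ks))
    = f k *\<^sub>R A xs ((pre @ [v k]) @ map (\<lambda>k. f k *\<^sub>R v k) ks)"
    by (simp add: slot_scale)
  then show ?case by (simp only: Cons.IH) simp
qed simp

text \<open>The prefix \<open>pre\<close> holds the arguments that have already been expanded.\<close>

lemma slots_sum:
  assumes "finite K"
  shows "A xs (pre @ replicate r (\<Sum>k\<in>K. v k))
    = (\<Sum>ks | set ks \<subseteq> K \<and> length ks = r. A xs (pre @ map v ks))"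
proof (induction r arbitrary: pre)
  case 0
  have "{ks. set ks \<subseteq> K \<and> length ks = 0} = {[]}" by auto
  then show ?case by simp
next
  case (Suc r)
  let ?L = "\<lambda>r. {ks. set ks \<subseteq> K \<and> length ks = r}"
  have L: "?L (Suc r) = (\<lambda>(k, ks). k # ks) ` (K \<times> ?L r)"
    by (auto simp: image_iff length_Suc_conv)
  have "A xs (pre @ replicate (Suc r) (\<Sum>k\<in>K. v k))
    = (\<Sum>k\<in>K. A xs ((pre @ [v k]) @ replicate r (\<Sum>k\<in>K. v k)))"
    by (simp add: slot_sum)
  also have "\<dots> = (\<Sum>k\<in>K. \<Sum>ks\<in>?L r. A xs (pre @ map v (k # ks)))"
    by (simp only: Suc.IH) simp
  also have "\<dots> = (\<Sum>ks\<in>?L (Suc r). A xs (pre @ map v ks))"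
    unfolding L by (subst sum.reindex)
      (auto simp: inj_on_def o_def case_prod_beta sum.cartesian_product)
  finally show ?case .
qed

definition solution_term :: "'p \<Rightarrow> nat \<Rightarrow> 'q" where
  "solution_term X n = (1 / fact n) *\<^sub>R series_solution A (replicate n X)"

text \<open>The term of \<open>\<Psi>(X, \<Phi>(X))\<close> obtained by choosing from the \<open>i\<close>-th factor \<open>\<Phi>(X)\<close> its part of degree \<open>k\<^sub>i\<close>.\<close>

definition substituted_term :: "'p \<Rightarrow> nat \<times> nat list \<Rightarrow> 'q" where
  "substituted_term X = (\<lambda>(m, ks).
     (1 / (fact m * fact (length ks))) *\<^sub>R A (replicate m X) (map (solution_term X) ks))"

lemma partial_sum1_solution:
  "partial_sum1 (*\<^sub>R) (series_solution A) X N = (\<Sum>n=1..N. solution_term X n)"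
  by (simp add: partial_sum1_def solution_term_def)

lemma solution_term_nonneg:
  assumes "0 \<le> X" "1 \<le> n"
  shows "0 \<le> solution_term X n"
  unfolding solution_term_def
  using assms by (intro scaleR_nonneg_nonneg series_solution_nonneg nonneg) auto

lemma substituted_term_nonneg:
  assumes "0 \<le> X" "0 \<notin> set ks" "1 \<le> m + length ks"
  shows "0 \<le> substituted_term X (m, ks)"
proof -
  have "0 \<le> solution_term X k" if "k \<in> set ks" for k
    using that assms by (intro solution_term_nonneg) (auto simp: Suc_le_eq intro!: gr0I)
  then have "0 \<le> A (replicate m X) (map (solution_term X) ks)"
    using assms by (intro nonneg) auto
  then show ?thesis unfolding substituted_term_def by (simp add: scaleR_nonneg_nonneg)
qed

text \<open>Equating terms of degree \<open>n\<close> in \<open>Y = \<Psi>(X, Y)\<close>. The factors \<open>k\<^sub>i!\<close> that multilinearity extracts from the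
  blocks cancel those in the multinomial count, and \<open>n choose m\<close> accounts for the sets \<open>M\<close> of size \<open>m\<close>.\<close>

lemma solution_term_expansion:
  "solution_term X n = (\<Sum>m\<le>n. \<Sum>ks\<in>compositions (n - m). substituted_term X (m, ks))"
proof -
  let ?T = "\<lambda>k. series_solution A (replicate k X)"
  let ?g = "\<lambda>m ks. A (replicate m X) (map ?T ks)"
  let ?G = "\<lambda>m. \<Sum>ks\<in>compositions (n - m). (fact (n - m) * fact m) *\<^sub>R substituted_term X (m, ks)"
  have T: "?T = (\<lambda>k. fact k *\<^sub>R solution_term X k)" by (simp add: solution_term_def)
  have g: "?g m ks = (\<Prod>k\<leftarrow>ks. fact k) *\<^sub>R A (replicate m X) (map (solution_term X) ks)" for m ks
    using slots_scale[of "replicate m X" "[]" fact "solution_term X" ks] unfolding T by simp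
  have prod: "(\<Prod>k\<leftarrow>ks. fact k :: real) \<noteq> 0" for ks :: "nat list"
    by (induction ks) auto
  have "?T n = (\<Sum>M\<in>Pow {..<n}. \<Sum>P | partition_on ({..<n} - M) P.
      A (nths (replicate n X) M) (map (\<lambda>S. series_solution A (nths (replicate n X) S)) (blocks P)))"
    using series_solution_full[where a = A, OF no_linear_term, of "replicate n X"] by simp
  also have "\<dots> = (\<Sum>M\<in>Pow {..<n}. ?G (card M))"
  proof (rule sum.cong[OF refl])
    fix M assume "M \<in> Pow {..<n}"
    then have M: "M \<subseteq> {..<n}" by simp
    then have card: "card ({..<n} - M) = n - card M"
      by (simp add: card_Diff_subset finite_subset)
    have "(\<Sum>P | partition_on ({..<n} - M) P.
        A (nths (replicate n X) M) (map (\<lambda>S. series_solution A (nths (replicate n X) S)) (blocks P)))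
      = (\<Sum>P | partition_on ({..<n} - M) P. ?g (card M) (map card (blocks P)))"
    proof (rule sum.cong[OF refl])
      fix P assume "P \<in> {P. partition_on ({..<n} - M) P}"
      then have P: "partition_on ({..<n} - M) P" by simp
      have "series_solution A (nths (replicate n X) S) = ?T (card S)" if "S \<in> set (blocks P)" for S
      proof -
        have "S \<in> P" using that set_blocks[OF P] by simp
        then have "S \<subseteq> {..<n}" using partition_onD1[OF P] by auto
        then show ?thesis by (simp add: nths_replicate)
      qed
      then have "map (\<lambda>S. series_solution A (nths (replicate n X) S)) (blocks P) = map ?T (map card (blocks P))"
        by simp
      then show "A (nths (replicate n X) M) (map (\<lambda>S. series_solution A (nths (replicate n X) S)) (blocks P))
        = ?g (card M) (map card (blocks P))"
        by (simp only: nths_replicate[OF M])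
    qed
    also have "\<dots> = (\<Sum>ks\<in>compositions (n - card M).
        (fact (n - card M) / (fact (length ks) * (\<Prod>k\<leftarrow>ks. fact k))) *\<^sub>R ?g (card M) ks)"
      unfolding card[symmetric]
    proof (rule sum_over_partitions)
      show "?g (card M) ks = ?g (card M) ls" if "mset ks = mset ls" for ks ls
        using symmetrical that unfolding completely_symmetrical_def by simp
    qed simp
    also have "\<dots> = ?G (card M)"
      unfolding g by (intro sum.cong refl) (simp add: substituted_term_def prod)
    finally show "(\<Sum>P | partition_on ({..<n} - M) P.
        A (nths (replicate n X) M) (map (\<lambda>S. series_solution A (nths (replicate n X) S)) (blocks P)))
      = ?G (card M)" .
  qed
  also have "Pow {..<n} = {M. M \<subseteq> {..<n} \<and> card M \<in> {..n}}"
    using card_mono[of "{..<n}"] by auto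
  also have "(\<Sum>M | M \<subseteq> {..<n} \<and> card M \<in> {..n}. ?G (card M)) = (\<Sum>m\<le>n. real (n choose m) *\<^sub>R ?G m)"
    using sum_over_subsets[of "{..<n}" "{..n}" ?G] by simp
  also have "\<dots> = (\<Sum>m\<le>n. fact n *\<^sub>R (\<Sum>ks\<in>compositions (n - m). substituted_term X (m, ks)))"
  proof (rule sum.cong[OF refl])
    fix m assume "m \<in> {..n}"
    then have "real (n choose m) * (fact (n - m) * fact m) = fact n"
      by (simp add: binomial_fact)
    then show "real (n choose m) *\<^sub>R ?G m
      = fact n *\<^sub>R (\<Sum>ks\<in>compositions (n - m). substituted_term X (m, ks))"
      by (simp add: scaleR_sum_right[symmetric])
  qed
  finally show ?thesis
    unfolding solution_term_def by (simp add: scaleR_sum_right[symmetric])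
qed

text \<open>A pair \<open>(m, ks)\<close> has degree \<open>m + sum_list ks\<close> in \<open>X\<close> and order \<open>m + length ks\<close> as a term of \<open>\<Psi>\<close>. The
  partial sums of \<open>\<Phi>(X)\<close> collect terms by degree, those of \<open>\<Psi>(X, S)\<close> by order; for \<open>S\<close> a sum of
  solution terms, both are sums of \<open>substituted_term\<close> over finite sets of pairs.\<close>

definition degree_index :: "nat \<Rightarrow> (nat \<times> nat list) set" where
  "degree_index N = {(m, ks). 0 \<notin> set ks \<and> 1 \<le> m + sum_list ks \<and> m + sum_list ks \<le> N}"

definition order_index :: "nat set \<Rightarrow> nat \<Rightarrow> (nat \<times> nat list) set" where
  "order_index K M = {(m, ks). set ks \<subseteq> K \<and> 1 \<le> m + length ks \<and> m + length ks \<le> M}"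

lemma finite_degree_index: "finite (degree_index N)"
proof (rule finite_subset)
  show "degree_index N \<subseteq> {..N} \<times> {ks. set ks \<subseteq> {..N} \<and> length ks \<le> N}"
    unfolding degree_index_def
    using length_le_sum_list member_le_sum_list by fastforce
qed (simp add: finite_lists_length_le)

lemma finite_order_index:
  assumes "finite K"
  shows "finite (order_index K M)"
proof (rule finite_subset)
  show "order_index K M \<subseteq> {..M} \<times> {ks. set ks \<subseteq> K \<and> length ks \<le> M}"
    unfolding order_index_def by auto
qed (simp add: finite_lists_length_le assms)

lemma partial_sum1_expansion:
  "partial_sum1 (*\<^sub>R) (series_solution A) X N = sum (substituted_term X) (degree_index N)"
proof -
  let ?d = "\<lambda>(m, ks). m + sum_list ks"
  have "sum (substituted_term X) (degree_index N)
    = (\<Sum>n=1..N. sum (substituted_term X) {p \<in> degree_index N. ?d p = n})"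
    by (rule sum.group[OF finite_degree_index, symmetric]) (auto simp: degree_index_def)
  also have "\<dots> = (\<Sum>n=1..N. solution_term X n)"
  proof (rule sum.cong[OF refl])
    fix n assume "n \<in> {1..N}"
    then have "{p \<in> degree_index N. ?d p = n} = (SIGMA m:{..n}. compositions (n - m))"
      unfolding degree_index_def compositions_def by auto
    then show "sum (substituted_term X) {p \<in> degree_index N. ?d p = n} = solution_term X n"
      by (simp add: solution_term_expansion sum.Sigma finite_compositions)
  qed
  finally show ?thesis by (simp add: partial_sum1_solution)
qed

lemma partial_sum2_expansion:
  assumes "finite K"
  shows "partial_sum2 (*\<^sub>R) A X (\<Sum>k\<in>K. solution_term X k) M
    = sum (substituted_term X) (order_index K M)"
proof -
  let ?D = "{(m, r). 1 \<le> m + r \<and> m + r \<le> M}"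
  let ?d = "\<lambda>(m, ks). (m, length ks)"
  have "sum (substituted_term X) (order_index K M)
    = (\<Sum>d\<in>?D. sum (substituted_term X) {p \<in> order_index K M. ?d p = d})"
    by (rule sum.group[OF finite_order_index[OF assms] finite_degrees, symmetric])
      (auto simp: order_index_def)
  also have "\<dots> = (\<Sum>(m, r)\<in>?D. (1 / (fact m * fact r)) *\<^sub>R
      A (replicate m X) (replicate r (\<Sum>k\<in>K. solution_term X k)))"
  proof (rule sum.cong[OF refl], clarify)
    fix m r :: nat assume "1 \<le> m + r" "m + r \<le> M"
    then have "{p \<in> order_index K M. ?d p = (m, r)} = Pair m ` {ks. set ks \<subseteq> K \<and> length ks = r}"
      unfolding order_index_def by auto
    then have "sum (substituted_term X) {p \<in> order_index K M. ?d p = (m, r)}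
      = (\<Sum>ks | set ks \<subseteq> K \<and> length ks = r. substituted_term X (m, ks))"
      by (simp add: sum.reindex inj_on_def o_def)
    also have "\<dots> = (\<Sum>ks | set ks \<subseteq> K \<and> length ks = r.
        (1 / (fact m * fact r)) *\<^sub>R A (replicate m X) (map (solution_term X) ks))"
      by (rule sum.cong) (auto simp: substituted_term_def)
    also have "\<dots> = (1 / (fact m * fact r)) *\<^sub>R
        A (replicate m X) (replicate r (\<Sum>k\<in>K. solution_term X k))"
      using slots_sum[OF assms, of "replicate m X" "[]" r "solution_term X"]
      by (simp add: scaleR_sum_right)
    finally show "sum (substituted_term X) {p \<in> order_index K M. ?d p = (m, r)}
      = (1 / (fact m * fact r)) *\<^sub>R A (replicate m X) (replicate r (\<Sum>k\<in>K. solution_term X k))" .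
  qed
  finally show ?thesis by (simp add: partial_sum2_def)
qed

text \<open>A block of size \<open>N + 1\<close> exhausts the degree \<open>N + 1\<close>, so it occurs only in the pair \<open>(0, [N + 1])\<close>. The
  order of a pair never exceeds its degree, since the blocks are nonempty.\<close>

lemma degree_index_Suc:
  "degree_index (Suc N) - {(0, [Suc N])} \<subseteq> order_index {1..N} (Suc N)"
proof
  fix p assume "p \<in> degree_index (Suc N) - {(0, [Suc N])}"
  moreover obtain m ks where "p = (m, ks)" by (cases p)
  ultimately have p: "p = (m, ks)" "(m, ks) \<noteq> (0, [Suc N])"
    and nz: "0 \<notin> set ks" and d: "1 \<le> m + sum_list ks" "m + sum_list ks \<le> Suc N"
    unfolding degree_index_def by auto
  have "Suc N \<notin> set ks"
  proof
    assume "Suc N \<in> set ks"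
    then obtain us vs where ks: "ks = us @ Suc N # vs" by (auto dest: split_list)
    then have "length us = 0" "length vs = 0" "m = 0"
      using d nz length_le_sum_list[of us] length_le_sum_list[of vs]
      by (auto simp del: sum_list_eq_0_iff)
    then show False using p ks by simp
  qed
  moreover have "k \<le> Suc N" if "k \<in> set ks" for k
    using member_le_sum_list[OF that] d by simp
  ultimately have "set ks \<subseteq> {1..N}"
    using nz by (metis atLeastAtMost_iff le_SucE less_one linorder_not_less subsetI)
  moreover have "1 \<le> m + length ks" using d by (cases ks) auto
  moreover have "m + length ks \<le> Suc N" using length_le_sum_list[OF nz] d by simp
  ultimately show "p \<in> order_index {1..N} (Suc N)" unfolding order_index_def p by simp
qed

lemma order_index_subset: "order_index {1..N} M \<subseteq> degree_index (M + M * N)"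
proof
  fix p assume "p \<in> order_index {1..N} M"
  then obtain m ks where p: "p = (m, ks)" and ks: "set ks \<subseteq> {1..N}"
    and d: "1 \<le> m + length ks" "m + length ks \<le> M"
    unfolding order_index_def by auto
  have nz: "0 \<notin> set ks" using ks by auto
  have "sum_list ks \<le> length ks * N" using ks by (induction ks) auto
  also have "\<dots> \<le> M * N" using d by (intro mult_right_mono) auto
  finally have "m + sum_list ks \<le> M + M * N" using d by simp
  moreover have "1 \<le> m + sum_list ks" using d length_le_sum_list[OF nz] by simp
  ultimately show "p \<in> degree_index (M + M * N)" unfolding degree_index_def p using nz by simp
qed

text \<open>The pair \<open>(0, [N + 1])\<close> contributes \<open>A\<^sub>0\<^sub>1(c\<^sub>N\<^sub>+\<^sub>1) = 0\<close>. This is what allows \<open>S\<^sub>N\<^sub>+\<^sub>1\<close> to be bounded by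
  means of \<open>S\<^sub>N\<close> alone.\<close>

lemma partial_sum1_Suc_le:
  assumes X: "0 \<le> X"
  shows "partial_sum1 (*\<^sub>R) (series_solution A) X (Suc N)
    \<le> partial_sum2 (*\<^sub>R) A X (partial_sum1 (*\<^sub>R) (series_solution A) X N) (Suc N)"
proof -
  have "partial_sum1 (*\<^sub>R) (series_solution A) X (Suc N)
    = sum (substituted_term X) (degree_index (Suc N) - {(0, [Suc N])})"
    unfolding partial_sum1_expansion
    by (rule sum.mono_neutral_right)
      (auto simp: finite_degree_index substituted_term_def no_linear_term)
  also have "\<dots> \<le> sum (substituted_term X) (order_index {1..N} (Suc N))"
  proof (rule sum_mono2)
    show "0 \<le> substituted_term X p" if "p \<in> order_index {1..N} (Suc N) - (degree_index (Suc N) - {(0, [Suc N])})" for p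
      using that by (cases p) (auto simp: order_index_def intro!: substituted_term_nonneg[OF X])
  qed (rule finite_order_index finite_atLeastAtMost degree_index_Suc)+
  also have "\<dots> = partial_sum2 (*\<^sub>R) A X (partial_sum1 (*\<^sub>R) (series_solution A) X N) (Suc N)"
    by (simp add: partial_sum1_solution partial_sum2_expansion)
  finally show ?thesis .
qed

lemma partial_sum2_le_partial_sum1:
  assumes X: "0 \<le> X"
  shows "partial_sum2 (*\<^sub>R) A X (partial_sum1 (*\<^sub>R) (series_solution A) X N) M
    \<le> partial_sum1 (*\<^sub>R) (series_solution A) X (M + M * N)"
proof -
  have "sum (substituted_term X) (order_index {1..N} M)
    \<le> sum (substituted_term X) (degree_index (M + M * N))"
  proof (rule sum_mono2)
    fix p assume "p \<in> degree_index (M + M * N) - order_index {1..N} M"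
    then obtain m ks where "p = (m, ks)" "0 \<notin> set ks" "1 \<le> m + sum_list ks"
      unfolding degree_index_def by auto
    moreover from this have "1 \<le> m + length ks" by (cases ks) auto
    ultimately show "0 \<le> substituted_term X p" using substituted_term_nonneg[OF X] by blast
  qed (rule finite_degree_index order_index_subset)+
  then show ?thesis
    by (simp only: partial_sum1_expansion[of X "M + M * N"] partial_sum1_solution[of X N]
        partial_sum2_expansion finite_atLeastAtMost)
qed

lemma incseq_partial_sum1:
  assumes "0 \<le> X"
  shows "incseq (partial_sum1 (*\<^sub>R) (series_solution A) X)"
  unfolding partial_sum1_solution incseq_def
  using assms by (auto intro!: sum_mono2 solution_term_nonneg)

lemma partial_sum1_nonneg:
  assumes "0 \<le> X"
  shows "0 \<le> partial_sum1 (*\<^sub>R) (series_solution A) X N"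
  unfolding partial_sum1_solution using assms by (auto intro!: sum_nonneg solution_term_nonneg)

end

context convergent_positive_series
begin

lemma partial_sum1_le_solution:
  assumes E: "(X, Z) \<in> E" and Z: "Psi A X Z \<le> Z"
  shows "partial_sum1 (*\<^sub>R) (series_solution A) X N \<le> Z"
proof (induction N)
  case 0
  then show ?case using star_nonneg[OF E] by (simp add: partial_sum1_def)
next
  case (Suc N)
  let ?S = "partial_sum1 (*\<^sub>R) (series_solution A) X"
  have "?S (Suc N) \<le> partial_sum2 (*\<^sub>R) A X (?S N) (Suc N)"
    using star_nonneg[OF E] by (intro partial_sum1_Suc_le) auto
  also have "\<dots> \<le> partial_sum2 (*\<^sub>R) A X Z (Suc N)"
    using star_nonneg[OF E] Suc by (intro partial_sum2_mono partial_sum1_nonneg) auto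
  also have "\<dots> \<le> Psi A X Z" by (rule increases_to_upper[OF Psi_increases_to[OF E]])
  finally show ?case using Z by (rule order_trans)
qed

text \<open>The supremum of the formal solution is a supersolution, hence above the iterates, and it is below every
  supersolution, hence below their supremum.\<close>

lemma series_solution_increases_to:
  assumes it: "iterate A X \<up> Z" and E: "(X, Z) \<in> E" and Z: "Psi A X Z = Z"
  shows "partial_sum1 (*\<^sub>R) (series_solution A) X \<up> Z"
proof -
  let ?S = "partial_sum1 (*\<^sub>R) (series_solution A) X"
  have X: "0 \<le> X" using star_nonneg[OF E] by simp
  have le: "?S N \<le> Z" for N using partial_sum1_le_solution[OF E] Z by simp
  obtain W where W: "?S \<up> W" using bounded_incseq_increases_to[OF incseq_partial_sum1[OF X] le] .
  have "0 \<le> W" using partial_sum1_nonneg[OF X, of 0] increases_to_upper[OF W, of 0] by (rule order_trans)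
  moreover have WZ: "W \<le> Z" by (rule increases_to_least[OF W le])
  ultimately have EW: "(X, W) \<in> E" by (rule star_below[OF E])
  have "Psi A X W \<le> W"
    using partial_sum2_le_partial_sum1[OF X] increases_to_upper[OF W]
    by (intro Psi_sup_le[OF EW partial_sum1_nonneg[OF X] W]) (blast intro: order_trans)
  then have "iterate A X p \<le> W" for p using iterate_le[OF EW] by blast
  then have "Z \<le> W" by (rule increases_to_least[OF it])
  with WZ W show ?thesis by simp
qed

lemma Delta1_solution:
  assumes "X \<in> Delta1 A E"
  obtains Z where "is_principal_solution A X Z" "partial_sum1 (*\<^sub>R) (series_solution A) X \<up> Z"
proof -
  obtain Y where "(X, Y) \<in> E" "Psi A X Y \<le> Y" using assms unfolding Delta1_def by blast
  then obtain Z where Z: "iterate A X \<up> Z" "(X, Z) \<in> E" "Psi A X Z = Z"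
    by (rule principal_solution_exists)
  then have "is_principal_solution A X Z"
    unfolding is_principal_solution_def increases_to_def by blast
  then show ?thesis using that series_solution_increases_to[OF Z] by blast
qed

end


section \<open>Convergence by majorization\<close>

text \<open>The Cauchy criterion: the tails of the majorant series are the regulator \<open>\<epsilon>\<close> for the majorized series.\<close>

lemma (in B_K_space) majorized_series_converges:
  fixes normX :: "'x1 \<Rightarrow> 'p::{zero, order}"
  assumes maj: "majorant1 normX nrm b B" and x: "normX x \<le> X"
    and B: "partial_sum1 (*\<^sub>R) B X \<up> Z"
  shows "\<exists>y. bk_converges nrm (partial_sum1 scale b x) y"
proof (rule bk_complete)
  let ?s = "partial_sum1 scale b x" and ?S = "partial_sum1 (*\<^sub>R) B X"
  have step: "nrm (scale (1 / fact n) (b (replicate n x))) \<le> (1 / fact n) *\<^sub>R B (replicate n X)"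
    if "1 \<le> n" for n
  proof -
    have "nrm (b (replicate n x)) \<le> B (replicate n X)"
      using maj that x unfolding majorant1_def by (simp add: list_all2_conv_all_nth)
    moreover have "norm (1 / fact n :: 'k) = 1 / fact n" by (simp add: norm_divide)
    ultimately show ?thesis by (simp only: nrm_scale) (simp add: scaleR_left_mono)
  qed
  have diff: "nrm (?s q - ?s p) \<le> ?S q - ?S p" if "p \<le> q" for p q
  proof -
    have I: "{1..q} - {1..p} = {p<..q}" "{1..p} \<subseteq> {1..q}" using that by auto
    have "?s q - ?s p = (\<Sum>n\<in>{p<..q}. scale (1 / fact n) (b (replicate n x)))"
      unfolding partial_sum1_def I(1)[symmetric] by (subst sum_diff) (use I in auto)
    moreover have "?S q - ?S p = (\<Sum>n\<in>{p<..q}. (1 / fact n) *\<^sub>R B (replicate n X))"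
      unfolding partial_sum1_def I(1)[symmetric] by (subst sum_diff) (use I in auto)
    ultimately show ?thesis by (simp only:) (rule nrm_sum_le, rule step, auto)
  qed
  show "bk_fundamental nrm ?s"
    unfolding bk_fundamental_def
  proof (intro exI conjI allI impI)
    show "(\<lambda>n. Z - ?S n) \<down> 0" by (rule decreases_to_gap[OF B])
    have le: "nrm (?s q - ?s p) \<le> Z - ?S n" if "n \<le> p" "p \<le> q" for n p q
    proof -
      have "?S n \<le> ?S p" using increases_to_incseq[OF B] that unfolding incseq_def by blast
      then have "?S q - ?S p \<le> Z - ?S n" using increases_to_upper[OF B] by (rule diff_mono[rotated])
      then show ?thesis using diff[OF that(2)] by (rule order_trans[rotated])
    qed
    show "nrm (?s p - ?s q) \<le> Z - ?S n" if "n \<le> p" "n \<le> q" for n p q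
      using le[of n p q] le[of n q p] that nrm_diff_commute[of "?s p"] by (cases "p \<le> q") auto
  qed
qed

theorem theorem7p1:
  fixes scaleX :: "'k::real_normed_field \<Rightarrow> 'x::ab_group_add \<Rightarrow> 'x"
    and scaleY :: "'k \<Rightarrow> 'y::ab_group_add \<Rightarrow> 'y"
    and normX :: "'x \<Rightarrow> 'p::sigma_complete_riesz_space"
    and normY :: "'y \<Rightarrow> 'q::sigma_complete_riesz_space"
    and A :: "'p list \<Rightarrow> 'q list \<Rightarrow> 'q"
    and a :: "'x list \<Rightarrow> 'y list \<Rightarrow> 'y"
    and E :: "('p \<times> 'q) set"
  assumes "lattice_normed_space scaleX normX"
    and "B_K_space scaleY normY"
    and "multilinear (*\<^sub>R) (*\<^sub>R) A" and "completely_symmetrical A"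
    and "multilinear scaleX scaleY a" and "completely_symmetrical a"
    and "continuous_monotone A"
    and "\<And>Y. A [] [Y] = 0" and "\<And>y. a [] [y] = 0"
    and "order_star E"
    and "\<And>X Y. (X, Y) \<in> E \<Longrightarrow> \<exists>Z. o_converges (partial_sum2 (*\<^sub>R) A X Y) Z"
    and "majorant2 normX normY a A"
  shows "Delta1 A E = Gamma1 A E \<and>
    (\<forall>X\<in>Delta1 A E. \<exists>Y. is_principal_solution A X Y \<and>
        o_converges (partial_sum1 (*\<^sub>R) (series_solution A) X) Y) \<and>
    majorant1 normX normY (series_solution a) (series_solution A) \<and>
    (\<forall>x. (\<exists>X\<in>Delta1 A E. normX x \<le> X) \<longrightarrow>
        (\<exists>y. bk_converges normY (partial_sum1 scaleY (series_solution a) x) y))"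
proof -
  interpret Y: B_K_space scaleY normY by fact
  have "0 \<le> A Xs Ys" if "Xs \<noteq> [] \<or> Ys \<noteq> []" "\<forall>X\<in>set Xs. 0 \<le> X" "\<forall>Y\<in>set Ys. 0 \<le> Y" for Xs Ys
    using assms(12) that unfolding majorant2_def by blast
  then interpret convergent_positive_series A E
    by unfold_locales (use assms in auto)
  have maj: "majorant1 normX normY (series_solution a) (series_solution A)"
    by (rule series_solution_majorant[OF Y.lattice_normed_space_axioms assms(12)])
  show ?thesis
  proof (intro conjI ballI allI impI)
    show "Delta1 A E = Gamma1 A E" by (rule Delta1_eq_Gamma1)
    show "majorant1 normX normY (series_solution a) (series_solution A)" by (rule maj)
    show "\<exists>Y. is_principal_solution A X Y \<and> o_converges (partial_sum1 (*\<^sub>R) (series_solution A) X) Y"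
      if X: "X \<in> Delta1 A E" for X
      using Delta1_solution[OF X] increases_to_o_converges by metis
    show "\<exists>y. bk_converges normY (partial_sum1 scaleY (series_solution a) x) y"
      if ex: "\<exists>X\<in>Delta1 A E. normX x \<le> X" for x
    proof -
      obtain X where X: "X \<in> Delta1 A E" and x: "normX x \<le> X" using ex by blast
      obtain Z where "partial_sum1 (*\<^sub>R) (series_solution A) X \<up> Z"
        using Delta1_solution[OF X] by blast
      then show ?thesis by (rule Y.majorized_series_converges[OF maj x])
    qed
  qed
qed

end
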